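(* Let $G$ be a finite, connected graph with the 4-cycle wheel property. Then there exists a normal covering map from $\mathbb{L}^2$ to $G$.
   Context: Graphs are simple. $\mathbb{L}^2$ is the graph with vertex set $\mathbb{Z}^2$ and edges $\{x,x+e_1\},\{x,x+e_2\}$ for $x\in\mathbb{Z}^2$. A graph $G$ has the 4-cycle wheel property if it is 4-regular and there is a family $\mathcal{C}$ of 4-cycles of $G$ such that every vertex $v$ lies in exactly four cycles of $\mathcal{C}$, and the union of these four 4-cycles is isomorphic to the $3\times 3$ grid graph (the subgraph of $\mathbb{L}^2$ induced by $\{-1,0,1\}^2$, with $v$ corresponding to the centre). A covering map from $F$ to $G$ is a graph homomorphism $p:V(F)\to V(G)$ mapping the neighbour set of each $v$ bijectively onto the neighbour set of $p(v)$. A covering transformation of $p$ is an automorphism $\phi$ of $F$ with $p\circ\phi=p$; $p$ is normal if the group of covering transformations acts transitively on each fibre of $p$. *)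

theory Defs
  imports
    "Graph_Theory.Graph_Theory"
    "HOL-Library.Product_Plus"
begin

text \<open>
  A simple graph is a symmetric, loop-free digraph whose arcs are pairs of vertices
  (\<^locale>\<open>pair_bidirected_digraph\<close>; \<^locale>\<open>pair_graph\<close> if finite): an undirected edge
  \<open>{u, v}\<close> is represented by the two arcs \<open>(u, v)\<close> and \<open>(v, u)\<close>.
\<close>

definition neighbours :: "'a pair_pre_digraph \<Rightarrow> 'a \<Rightarrow> 'a set" where
  "neighbours G v = {w. (v, w) \<in> parcs G}"

definition regular :: "nat \<Rightarrow> 'a pair_pre_digraph \<Rightarrow> bool" where
  "regular k G \<longleftrightarrow> (\<forall>v \<in> pverts G. card (neighbours G v) = k)"

text \<open>
  The underlying vertex map of an isomorphism in the sense of \<open>Graph_Theory\<close>. For digraphs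
  without parallel arcs it determines the arc map; see \<open>graph_iso_iff\<close>.
\<close>

definition graph_iso :: "('a \<Rightarrow> 'c) \<Rightarrow> ('a, 'b) pre_digraph \<Rightarrow> ('c, 'd) pre_digraph \<Rightarrow> bool" where
  "graph_iso \<phi> G H \<longleftrightarrow>
     (\<exists>f. pre_digraph.digraph_isomorphism G f \<and> iso_verts f = \<phi> \<and> app_iso f G = H)"

lemma graph_iso_iff:
  assumes "pair_wf_digraph G" "pair_wf_digraph H"
  shows "graph_iso \<phi> (with_proj G) (with_proj H) \<longleftrightarrow>
    bij_betw \<phi> (pverts G) (pverts H) \<and>
    (\<forall>u \<in> pverts G. \<forall>v \<in> pverts G. (\<phi> u, \<phi> v) \<in> parcs H \<longleftrightarrow> (u, v) \<in> parcs G)"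
    (is "?L \<longleftrightarrow> ?R")
proof
  interpret G: pair_wf_digraph G by fact
  assume ?L
  then obtain f where f: "pre_digraph.digraph_isomorphism (with_proj G) f"
    "iso_verts f = \<phi>" "app_iso f (with_proj G) = with_proj H"
    unfolding graph_iso_def by blast
  have eqs: "\<phi> ` pverts G = pverts H" "iso_arcs f ` parcs G = parcs H"
    "iso_tail f = fst" "iso_head f = snd"
    using f(3) by (auto simp: app_iso_def with_proj_def f(2))
  have inj: "inj_on \<phi> (pverts G)"
    using f(1) by (simp add: pre_digraph.digraph_isomorphism_def f(2))
  have arcs: "iso_arcs f (u, v) = (\<phi> u, \<phi> v)" if "(u, v) \<in> parcs G" for u v
    using f(1) that by (force simp: pre_digraph.digraph_isomorphism_def f(2) eqs prod_eq_iff)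
  have "(u, v) \<in> parcs G"
    if uv: "u \<in> pverts G" "v \<in> pverts G" "(\<phi> u, \<phi> v) \<in> parcs H" for u v
  proof -
    from uv(3) eqs(2) obtain u' v' where *: "(u', v') \<in> parcs G" "iso_arcs f (u', v') = (\<phi> u, \<phi> v)"
      by (metis imageE surj_pair)
    with arcs have "\<phi> u' = \<phi> u" "\<phi> v' = \<phi> v" by auto
    with uv inj * G.in_arcsD1 G.in_arcsD2 show ?thesis by (metis inj_onD)
  qed
  moreover have "(\<phi> u, \<phi> v) \<in> parcs H" if "(u, v) \<in> parcs G" for u v
    using that arcs[OF that] eqs(2) by (metis imageI)
  ultimately show ?R using inj eqs(1) by (auto simp: bij_betw_def)
next
  interpret G: pair_wf_digraph G by fact
  interpret H: pair_wf_digraph H by fact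
  assume R: ?R
  define f where "f = \<lparr>iso_verts = \<phi>, iso_arcs = map_prod \<phi> \<phi>, iso_head = snd, iso_tail = fst\<rparr>"
  have inj: "inj_on \<phi> (pverts G)" and im: "\<phi> ` pverts G = pverts H"
    using R by (auto simp: bij_betw_def)
  have "inj_on (map_prod \<phi> \<phi>) (parcs G)"
    using map_prod_inj_on[OF inj inj]
    by (rule inj_on_subset) (auto dest: G.in_arcsD1 G.in_arcsD2)
  then have "pre_digraph.digraph_isomorphism (with_proj G) f"
    using inj G.wf_digraph by (simp add: pre_digraph.digraph_isomorphism_def f_def)
  moreover have "map_prod \<phi> \<phi> ` parcs G = parcs H"
  proof
    show "map_prod \<phi> \<phi> ` parcs G \<subseteq> parcs H"
      using R by (auto dest: G.in_arcsD1 G.in_arcsD2)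
    show "parcs H \<subseteq> map_prod \<phi> \<phi> ` parcs G"
    proof
      fix e assume e: "e \<in> parcs H"
      obtain x y where xy: "e = (x, y)" by fastforce
      with e have "x \<in> \<phi> ` pverts G" "y \<in> \<phi> ` pverts G"
        using im H.in_arcsD1 H.in_arcsD2 by auto
      then obtain u v where "u \<in> pverts G" "v \<in> pverts G" "x = \<phi> u" "y = \<phi> v" by blast
      with R e xy show "e \<in> map_prod \<phi> \<phi> ` parcs G"
        by (metis image_eqI map_prod_simp)
    qed
  qed
  ultimately show ?L
    unfolding graph_iso_def
    by (intro exI[of _ f]) (simp add: app_iso_def with_proj_def im, simp add: f_def im)
qed

definition square_lattice :: "(int \<times> int) pair_pre_digraph" (\<open>\<L>\<^sup>2\<close>) where
  "\<L>\<^sup>2 = mk_symmetric (with_proj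
     \<lparr> pverts = UNIV, parcs = {(x, x + e) |x e. e \<in> {(1, 0), (0, 1)}} \<rparr>)"

lemma pverts_square_lattice [simp]: "pverts \<L>\<^sup>2 = UNIV"
  by (simp add: square_lattice_def mk_symmetric_def)

lemma parcs_square_lattice_iff:
  "(x, y) \<in> parcs \<L>\<^sup>2 \<longleftrightarrow> (\<exists>e \<in> {(1, 0), (0, 1)}. y = x + e \<or> x = y + e)"
proof -
  have "parcs \<L>\<^sup>2 = (\<Union>(u, v) \<in> {(x, x + e) |x e. e \<in> {(1, 0), (0, 1)}}. {(u, v), (v, u)})"
    by (simp add: square_lattice_def mk_symmetric_def case_prod_unfold)
  then show ?thesis by blast
qed

lemma pair_bidirected_digraph_square_lattice: "pair_bidirected_digraph \<L>\<^sup>2"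
  by unfold_locales (auto simp: symmetric_def sym_def parcs_square_lattice_iff)

definition grid3 :: "(int \<times> int, (int \<times> int) \<times> (int \<times> int)) pre_digraph" where
  "grid3 = with_proj \<L>\<^sup>2 \<restriction> ({-1..1} \<times> {-1..1})"

definition four_cycle :: "'a pair_pre_digraph \<Rightarrow> bool" where
  "four_cycle H \<longleftrightarrow> (\<exists>a b c d. distinct [a, b, c, d] \<and>
     H = mk_symmetric (with_proj
       \<lparr> pverts = {a, b, c, d}, parcs = {(a, b), (b, c), (c, d), (d, a)} \<rparr>))"

definition four_cycle_wheel_property :: "'a pair_pre_digraph \<Rightarrow> bool" where
  "four_cycle_wheel_property G \<longleftrightarrow> regular 4 G \<and>
     (\<exists>\<C>. (\<forall>H \<in> \<C>. four_cycle H \<and> subgraph (with_proj H) (with_proj G)) \<and>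
       (\<forall>v \<in> pverts G. card {H \<in> \<C>. v \<in> pverts H} = 4 \<and>
         (\<exists>\<phi>. graph_iso \<phi>
                (pre_digraph.Union (with_proj G) (with_proj ` {H \<in> \<C>. v \<in> pverts H})) grid3 \<and>
              \<phi> v = (0, 0))))"

definition graph_hom :: "('a \<Rightarrow> 'b) \<Rightarrow> 'a pair_pre_digraph \<Rightarrow> 'b pair_pre_digraph \<Rightarrow> bool" where
  "graph_hom p F G \<longleftrightarrow> p \<in> pverts F \<rightarrow> pverts G \<and> (\<forall>(u, v) \<in> parcs F. (p u, p v) \<in> parcs G)"

definition covering_map :: "('a \<Rightarrow> 'b) \<Rightarrow> 'a pair_pre_digraph \<Rightarrow> 'b pair_pre_digraph \<Rightarrow> bool" where
  "covering_map p F G \<longleftrightarrow> graph_hom p F G \<and>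
     (\<forall>v \<in> pverts F. bij_betw p (neighbours F v) (neighbours G (p v)))"

definition covering_transformations :: "('a \<Rightarrow> 'b) \<Rightarrow> 'a pair_pre_digraph \<Rightarrow> ('a \<Rightarrow> 'a) set" where
  "covering_transformations p F =
     {\<phi>. graph_iso \<phi> (with_proj F) (with_proj F) \<and> (\<forall>v \<in> pverts F. p (\<phi> v) = p v)}"

definition normal_covering_map :: "('a \<Rightarrow> 'b) \<Rightarrow> 'a pair_pre_digraph \<Rightarrow> 'b pair_pre_digraph \<Rightarrow> bool" where
  "normal_covering_map p F G \<longleftrightarrow> covering_map p F G \<and>
     (\<forall>x \<in> pverts G. \<forall>u \<in> {w \<in> pverts F. p w = x}. \<forall>v \<in> {w \<in> pverts F. p w = x}.
        \<exists>\<phi> \<in> covering_transformations p F. \<phi> u = v)"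

end

theory Submission
  imports Defs
begin

text \<open>
  A frame is a vertex \<open>v\<close> with two neighbours \<open>a, b\<close> that lie with \<open>v\<close> on a common square
  \<open>v, a, c, b\<close>. Translating a frame along its first axis sends it to \<open>(a, a', c)\<close>, where \<open>a'\<close> is the
  neighbour of \<open>a\<close> opposite to \<open>v\<close>; the second axis is treated symmetrically. Since every edge lies
  on exactly two squares, the two translations are commuting permutations
  of the frames, so \<open>\<int> \<times> \<int>\<close> acts, and the base vertices of the orbit of a frame give the covering map.
  Swapping the axes and reversing the first axis relate any two frames at the same vertex and
  normalise the action; hence two lattice points with the same image differ by a covering
  transformation.
\<close>

section \<open>Integer powers of a permutation\<close>

definition zpow :: "('b \<Rightarrow> 'b) \<Rightarrow> int \<Rightarrow> 'b \<Rightarrow> 'b" where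
  "zpow f n = (if 0 \<le> n then f ^^ nat n else inv f ^^ nat (- n))"

lemma zpow_0 [simp]: "zpow f 0 x = x"
  by (simp add: zpow_def)

lemma zpow_add_1:
  assumes "bij f"
  shows "zpow f (n + 1) x = f (zpow f n x)"
proof (cases "0 \<le> n")
  case True
  then have "nat (n + 1) = Suc (nat n)" by simp
  with True show ?thesis by (simp add: zpow_def)
next
  case False
  then have "nat (- n) = Suc (nat (- (n + 1)))" by simp
  with False show ?thesis
    using assms by (auto simp: zpow_def bij_is_surj surj_f_inv_f)
qed

lemma zpow_diff_1:
  assumes "bij f"
  shows "zpow f (n - 1) x = inv f (zpow f n x)"
  using zpow_add_1[OF assms, of "n - 1" x] assms by (simp add: bij_is_inj inv_f_f)

lemma zpow_add:
  assumes "bij f"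
  shows "zpow f (m + n) x = zpow f m (zpow f n x)"
proof (induction m rule: int_induct[where k = 0])
  case (step1 i)
  then show ?case using zpow_add_1[OF assms, of "i + n"] zpow_add_1[OF assms, of i]
    by (simp add: ac_simps)
next
  case (step2 i)
  then show ?case using zpow_diff_1[OF assms, of "i + n"] zpow_diff_1[OF assms, of i]
    by (simp add: algebra_simps)
qed simp

text \<open>If \<open>h\<close> carries one step of \<open>f\<close> to one step of
  \<open>g\<close>, it also carries inverse steps, so induction in both directions reaches all
  integer powers. This yields the commutation and the symmetries of the action below.\<close>

lemma zpow_intertwine:
  assumes "bij f" "bij g" "\<And>x. h (f x) = g (h x)"
  shows "h (zpow f n x) = zpow g n (h x)"
proof (induction n rule: int_induct[where k = 0])
  case (step1 i)
  then show ?case by (simp add: zpow_add_1 assms)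
next
  case (step2 i)
  have "h (inv f y) = inv g (h y)" for y
    by (metis assms bij_inv_eq_iff)
  with step2 show ?case by (simp add: zpow_diff_1 assms)
qed simp

lemma zpow_inv:
  assumes "bij f"
  shows "zpow (inv f) n x = zpow f (- n) x"
  using assms by (auto simp: zpow_def inv_inv_eq)

section \<open>Frames and translations\<close>

definition unit_steps :: "(int \<times> int) set" where
  "unit_steps = {(1, 0), (0, 1), (-1, 0), (0, -1)}"

lemma uminus_unit_steps: "e \<in> unit_steps \<Longrightarrow> - e \<in> unit_steps"
  by (auto simp: unit_steps_def)

text \<open>The two inequalities say that \<open>e\<close> and \<open>f\<close> are perpendicular;
  the four signed steps then exhaust \<open>unit_steps\<close> by counting.\<close>

lemma unit_steps_eq:
  assumes "e \<in> unit_steps" "f \<in> unit_steps" "f \<noteq> e" "f \<noteq> - e"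
  shows "distinct [e, - e, f, - f]" and "unit_steps = {e, - e, f, - f}"
proof -
  have "- e \<noteq> e" "- f \<noteq> f"
    using assms(1,2) by (auto simp: unit_steps_def)
  moreover have "e \<noteq> - f" using assms(4) by (metis minus_minus)
  ultimately show d: "distinct [e, - e, f, - f]"
    using assms(3,4) by (simp add: eq_commute)
  have "card {e, - e, f, - f} = card unit_steps"
    using distinct_card[OF d] by (simp add: unit_steps_def)
  moreover have "{e, - e, f, - f} \<subseteq> unit_steps"
    using assms(1,2) by (simp add: uminus_unit_steps)
  ultimately show "unit_steps = {e, - e, f, - f}"
    by (intro card_subset_eq[symmetric]) (simp_all add: unit_steps_def)
qed

text \<open>
  \<open>Q a c b\<close> says that \<open>a, c, b\<close> complete the centre of the star to a square, \<open>c\<close> being the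
  corner opposite to the centre.
\<close>

definition star_chart :: "'a set \<Rightarrow> ('a \<Rightarrow> 'a \<Rightarrow> 'a \<Rightarrow> bool) \<Rightarrow> (int \<times> int \<Rightarrow> 'a) \<Rightarrow> bool" where
  "star_chart N Q \<psi> \<longleftrightarrow> inj_on \<psi> unit_steps \<and> N = \<psi> ` unit_steps \<and>
     (\<forall>a c b. Q a c b \<longleftrightarrow> (\<exists>e\<in>unit_steps. \<exists>f\<in>unit_steps.
        f \<noteq> e \<and> f \<noteq> - e \<and> a = \<psi> e \<and> b = \<psi> f \<and> c = \<psi> (e + f)))"

lemma star_chart_inj: "star_chart N Q \<psi> \<Longrightarrow> inj_on \<psi> unit_steps"
  and star_chart_image: "star_chart N Q \<psi> \<Longrightarrow> N = \<psi> ` unit_steps"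
  by (simp_all add: star_chart_def)

lemma star_chartI:
  assumes "star_chart N Q \<psi>" "e \<in> unit_steps" "f \<in> unit_steps" "f \<noteq> e" "f \<noteq> - e"
  shows "Q (\<psi> e) (\<psi> (e + f)) (\<psi> f)"
  using assms unfolding star_chart_def by blast

lemma star_chartE:
  assumes "star_chart N Q \<psi>" "Q a c b"
  obtains e f where "e \<in> unit_steps" "f \<in> unit_steps" "f \<noteq> e" "f \<noteq> - e"
    "a = \<psi> e" "b = \<psi> f" "c = \<psi> (e + f)"
  using assms unfolding star_chart_def by blast

text \<open>Distils the wheel property: \<open>sq\<close> lists the corners of a square in cyclic
  order, and the squares at a vertex are arranged like the four unit squares at the lattice
  origin.\<close>

locale square_complex =
  fixes V :: "'a set" and nb :: "'a \<Rightarrow> 'a set" and sq :: "'a \<Rightarrow> 'a \<Rightarrow> 'a \<Rightarrow> 'a \<Rightarrow> bool"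
  assumes sq_rot: "sq a b c d \<Longrightarrow> sq b c d a"
    and sq_flip: "sq a b c d \<Longrightarrow> sq a d c b"
    and sq_vertex: "sq a b c d \<Longrightarrow> a \<in> V"
    and star: "v \<in> V \<Longrightarrow> \<exists>\<psi>. star_chart (nb v) (sq v) \<psi>"
begin

text \<open>Straight continuation through \<open>v\<close>, expressed by squares alone so that it
  does not depend on a chart.\<close>

definition opp :: "'a \<Rightarrow> 'a \<Rightarrow> 'a" where
  "opp v a = (THE a'. a' \<in> nb v \<and> a' \<noteq> a \<and> (\<nexists>c. sq v a c a'))"

definition fourth :: "'a \<Rightarrow> 'a \<Rightarrow> 'a \<Rightarrow> 'a" where
  "fourth v a b = (THE c. sq v a c b)"

lemma chart_opp:
  assumes "star_chart (nb v) (sq v) \<psi>" and e: "e \<in> unit_steps"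
  shows "opp v (\<psi> e) = \<psi> (- e)"
  unfolding opp_def
proof (rule the_equality)
  note \<psi> = star_chart_inj[OF assms(1)] star_chart_image[OF assms(1)]
  have me: "- e \<in> unit_steps" "- e \<noteq> e" using e by (auto simp: unit_steps_def)
  \<comment> \<open>A square at \<open>v\<close> is spanned by perpendicular steps, and injectivity
    of the chart would make these \<open>e\<close> and \<open>- e\<close>.\<close>
  have "\<not> sq v (\<psi> e) c (\<psi> (- e))" for c
  proof
    assume "sq v (\<psi> e) c (\<psi> (- e))"
    from star_chartE[OF assms(1) this] obtain x y where
      "x \<in> unit_steps" "y \<in> unit_steps" "y \<noteq> - x" "\<psi> e = \<psi> x" "\<psi> (- e) = \<psi> y"
      by metis
    then show False using inj_onD[OF \<psi>(1)] e me by metis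
  qed
  then show "\<psi> (- e) \<in> nb v \<and> \<psi> (- e) \<noteq> \<psi> e \<and> (\<nexists>c. sq v (\<psi> e) c (\<psi> (- e)))"
    using inj_onD[OF \<psi>(1) _ me(1) e] me \<psi>(2) by blast
  fix a' assume a': "a' \<in> nb v \<and> a' \<noteq> \<psi> e \<and> (\<nexists>c. sq v (\<psi> e) c a')"
  then obtain f where "f \<in> unit_steps" "a' = \<psi> f" using \<psi>(2) by blast
  \<comment> \<open>Any step other than \<open>e\<close> and \<open>- e\<close> is perpendicular to
    \<open>e\<close> and spans a square with it.\<close>
  with a' show "a' = \<psi> (- e)" using star_chartI[OF assms(1) e] by metis
qed

lemma sq_chart:
  assumes "sq v a c b"
  obtains \<psi> e f where "star_chart (nb v) (sq v) \<psi>" "e \<in> unit_steps" "f \<in> unit_steps" "f \<noteq> e" "f \<noteq> - e"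
    "a = \<psi> e" "b = \<psi> f" "c = \<psi> (e + f)"
proof -
  obtain \<psi> where \<psi>: "star_chart (nb v) (sq v) \<psi>" using star[OF sq_vertex[OF assms]] ..
  show thesis by (rule star_chartE[OF \<psi> assms]) (rule that[OF \<psi>])
qed

lemma sq_unique:
  assumes "sq v a c b" "sq v a c' b"
  shows "c = c'"
proof -
  obtain \<psi> e f where \<psi>: "star_chart (nb v) (sq v) \<psi>" and ef: "e \<in> unit_steps" "f \<in> unit_steps"
    "a = \<psi> e" "b = \<psi> f" "c = \<psi> (e + f)"
    using sq_chart[OF assms(1)] by metis
  obtain e' f' where "e' \<in> unit_steps" "f' \<in> unit_steps" "a = \<psi> e'" "b = \<psi> f'" "c' = \<psi> (e' + f')"
    using star_chartE[OF \<psi> assms(2)] by metis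
  with ef inj_onD[OF star_chart_inj[OF \<psi>]] show ?thesis by metis
qed

lemma fourth_eq: "sq v a c b \<Longrightarrow> fourth v a b = c"
  unfolding fourth_def using sq_unique by blast

text \<open>The same square read from \<open>a\<close> instead of \<open>v\<close>.\<close>

lemma sq_reverse: "sq v a c b \<Longrightarrow> sq a v b c"
  using sq_rot sq_flip by blast

lemma opp_opp:
  assumes "sq v a c b"
  shows "opp v (opp v a) = a"
  by (rule sq_chart[OF assms]) (simp add: chart_opp uminus_unit_steps)

lemma sq_opp:
  assumes "sq v a c b"
  shows "\<exists>d. sq v (opp v a) d b"
proof (rule sq_chart[OF assms])
  fix \<psi> e f
  assume *: "star_chart (nb v) (sq v) \<psi>" "e \<in> unit_steps" "f \<in> unit_steps" "f \<noteq> e" "f \<noteq> - e"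
    "a = \<psi> e" "b = \<psi> f"
  then have "sq v (\<psi> (- e)) (\<psi> (- e + f)) (\<psi> f)"
    by (intro star_chartI[OF *(1)]) (auto simp: uminus_unit_steps)
  with * show ?thesis by (auto simp: chart_opp)
qed

lemma nb_sq:
  assumes "sq v a c b"
  shows "nb v = {a, opp v a, b, opp v b}" "distinct [a, opp v a, b, opp v b]"
proof -
  obtain \<psi> e f where \<psi>: "star_chart (nb v) (sq v) \<psi>"
    and ef: "e \<in> unit_steps" "f \<in> unit_steps" "f \<noteq> e" "f \<noteq> - e" "a = \<psi> e" "b = \<psi> f"
    using sq_chart[OF assms] by metis
  have us: "unit_steps = {e, - e, f, - f}" "distinct [e, - e, f, - f]"
    using unit_steps_eq[OF ef(1-4)] by simp_all
  show "nb v = {a, opp v a, b, opp v b}"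
    unfolding star_chart_image[OF \<psi>] us(1) using ef by (simp add: chart_opp[OF \<psi>])
  have "distinct (map \<psi> [e, - e, f, - f])"
    unfolding distinct_map using us star_chart_inj[OF \<psi>] by simp
  then show "distinct [a, opp v a, b, opp v b]"
    using ef by (simp add: chart_opp[OF \<psi>])
qed

text \<open>An edge lies on at most two squares: at \<open>v\<close>, the further side of a square
  on the edge \<open>v a\<close> is neither \<open>a\<close> nor \<open>opp v a\<close>, which
  leaves two of the four neighbours.\<close>

lemma sq_two:
  assumes "sq v a c b" "sq v a c' b'" "b \<noteq> b'"
  shows "b' = opp v b"
proof -
  have "b' \<in> {a, opp v a, b, opp v b}" "b' \<noteq> a" "b' \<noteq> opp v a"
    using nb_sq[OF assms(1)] nb_sq[OF assms(2)] by auto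
  with assms(3) show ?thesis by auto
qed

lemma ex_sq:
  assumes "v \<in> V"
  shows "\<exists>a c b. sq v a c b"
proof -
  obtain \<psi> where "star_chart (nb v) (sq v) \<psi>" using star[OF assms] ..
  from star_chartI[OF this, of "(1, 0)" "(0, 1)"] show ?thesis
    by (auto simp: unit_steps_def)
qed

section \<open>Translations and reflections of frames\<close>

definition frames :: "('a \<times> 'a \<times> 'a) set" where
  "frames = {(v, a, b). \<exists>c. sq v a c b}"

fun swap :: "'a \<times> 'a \<times> 'a \<Rightarrow> 'a \<times> 'a \<times> 'a" where
  "swap (v, a, b) = (v, b, a)"

text \<open>
  \<open>mirror\<close> and \<open>right\<close> are the identity off the frames, so that they are permutations of the whole type.
\<close>

fun mirror :: "'a \<times> 'a \<times> 'a \<Rightarrow> 'a \<times> 'a \<times> 'a" where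
  "mirror (v, a, b) = (if (v, a, b) \<in> frames then (v, opp v a, b) else (v, a, b))"

fun right :: "'a \<times> 'a \<times> 'a \<Rightarrow> 'a \<times> 'a \<times> 'a" where
  "right (v, a, b) =
    (if (v, a, b) \<in> frames then (a, opp a v, fourth v a b) else (v, a, b))"

definition up :: "'a \<times> 'a \<times> 'a \<Rightarrow> 'a \<times> 'a \<times> 'a" where
  "up f = swap (right (swap f))"

lemma frame_iff [simp]: "(v, a, b) \<in> frames \<longleftrightarrow> (\<exists>c. sq v a c b)"
  by (simp add: frames_def)

lemma swap_swap [simp]: "swap (swap f) = f"
  by (cases f) simp

lemma swap_frame [simp]: "swap f \<in> frames \<longleftrightarrow> f \<in> frames"
  by (cases f) (auto dest: sq_flip)

lemma mirror_eq: "sq v a c b \<Longrightarrow> mirror (v, a, b) = (v, opp v a, b)"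
  by auto

lemma right_eq: "sq v a c b \<Longrightarrow> right (v, a, b) = (a, opp a v, c)"
  by (auto simp: fourth_eq)

lemma up_eq: "sq v a c b \<Longrightarrow> up (v, a, b) = (b, c, opp b v)"
  using right_eq[OF sq_flip] by (simp add: up_def del: right.simps)

declare mirror.simps [simp del] right.simps [simp del]

lemma non_frame:
  "f \<notin> frames \<Longrightarrow> mirror f = f" "f \<notin> frames \<Longrightarrow> right f = f" "f \<notin> frames \<Longrightarrow> up f = f"
  unfolding up_def by (cases f; auto simp: mirror.simps right.simps dest: sq_flip)+

lemma mirror_frame: "f \<in> frames \<Longrightarrow> mirror f \<in> frames"
  by (cases f) (auto simp: mirror_eq sq_opp)

lemma right_sq:
  assumes "sq v a c b"
  shows "\<exists>d. sq a (opp a v) d c"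
  by (rule sq_opp[OF sq_reverse[OF assms]])

lemma right_frame: "f \<in> frames \<Longrightarrow> right f \<in> frames"
  by (cases f) (auto simp: right_eq right_sq)

lemma up_frame: "f \<in> frames \<Longrightarrow> up f \<in> frames"
  by (simp add: up_def right_frame)

lemma mirror_mirror [simp]: "mirror (mirror f) = f"
proof (cases "f \<in> frames")
  case True
  then obtain v a b c where [simp]: "f = (v, a, b)" and c: "sq v a c b" by (cases f) auto
  with sq_opp[OF c] show ?thesis by (auto simp: mirror_eq opp_opp)
qed (simp add: non_frame)

text \<open>\<open>mirror (right f)\<close> is \<open>(a, v, c)\<close>, the same square seen from
  \<open>a\<close> looking back, so translating and then mirroring is an involution. This makes
  \<open>right\<close> invertible, with inverse its conjugate by \<open>mirror\<close>.\<close>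

lemma mirror_right_mirror_right [simp]: "mirror (right (mirror (right f))) = f"
proof (cases "f \<in> frames")
  case True
  then obtain v a b c where [simp]: "f = (v, a, b)" and c: "sq v a c b" by (cases f) auto
  have c': "sq a v b c" using c by (rule sq_reverse)
  have r: "mirror (right f) = (a, v, c)"
    using c right_sq[OF c] by (auto simp: right_eq mirror_eq opp_opp[OF c'])
  have "right (mirror (right f)) = (v, opp v a, b)"
    unfolding r by (rule right_eq[OF c'])
  then show ?thesis using sq_opp[OF c] by (auto simp: mirror_eq opp_opp[OF c])
qed (simp add: non_frame)

lemma bij_swap: "bij swap"
  by (rule o_bij[of swap]) (auto simp: fun_eq_iff)

lemma right_mirror_right_mirror [simp]: "right (mirror (right (mirror f))) = f"
  by (metis mirror_mirror mirror_right_mirror_right)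

lemma bij_right: "bij right"
  by (rule o_bij[of "mirror \<circ> right \<circ> mirror"]) (auto simp: fun_eq_iff)

lemma inv_right: "inv right f = mirror (right (mirror f))"
  by (rule inv_f_eq) (auto simp: bij_right bij_is_inj)

lemma up_o: "up = swap \<circ> right \<circ> swap"
  by (simp add: fun_eq_iff up_def)

lemma bij_up: "bij up"
  unfolding up_o by (intro bij_comp bij_swap bij_right)

lemma inv_up: "inv up f = swap (inv right (swap f))"
  by (rule inv_f_eq) (auto simp: bij_up bij_is_inj up_def bij_right bij_is_surj surj_f_inv_f)

text \<open>The squares on either side of the edge \<open>v b\<close> meet at \<open>b\<close>,
  where their further sides \<open>c\<close> and \<open>d\<close> are opposite by
  \<open>sq_two\<close>.\<close>

lemma mirror_up: "mirror (up f) = up (mirror f)"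
proof (cases "f \<in> frames")
  case True
  then obtain v a b c where [simp]: "f = (v, a, b)" and c: "sq v a c b" by (cases f) auto
  obtain d where d: "sq v (opp v a) d b" using sq_opp[OF c] ..
  have b: "sq b v a c" "sq b v (opp v a) d"
    using c d sq_rot sq_flip by blast+
  \<comment> \<open>If \<open>c = d\<close>, uniqueness of the corner opposite to \<open>b\<close>
    would give \<open>a = opp v a\<close>.\<close>
  have "c \<noteq> d" using sq_unique[of b v a c "opp v a"] b nb_sq(2)[OF c] by auto
  have "d = opp b c" using sq_two[OF b \<open>c \<noteq> d\<close>] .
  have "mirror (up f) = (b, opp b c, opp b v)"
    using up_frame[OF True] c by (auto simp: up_eq mirror_eq)
  moreover have "up (mirror f) = (b, d, opp b v)"
    using c d by (auto simp: mirror_eq up_eq)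
  ultimately show ?thesis using \<open>d = opp b c\<close> by simp
qed (simp add: non_frame)

text \<open>Both composites are based at the corner \<open>c\<close> opposite to \<open>v\<close>;
  their axes agree because the two squares on an edge ending at \<open>c\<close> have opposite sides
  there.\<close>

lemma right_up: "right (up f) = up (right f)"
proof (cases "f \<in> frames")
  case True
  then obtain v a b c where [simp]: "f = (v, a, b)" and c: "sq v a c b" by (cases f) auto
  \<comment> \<open>Stated for arbitrary \<open>a\<close> and \<open>b'\<close>, since it is used
    once for each axis.\<close>
  have fourth_right: "d = opp c b'"
    if s: "sq v a c b'" and d: "sq a (opp a v) d c" for a b' d
  proof -
    have "sq c a v b'" "sq c a (opp a v) d"
      using s d sq_rot sq_flip by blast+
    moreover have "b' \<noteq> d"
      using sq_unique calculation nb_sq(2)[OF sq_reverse[OF s]] by fastforce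
    ultimately show ?thesis by (rule sq_two)
  qed
  obtain d where d: "sq a (opp a v) d c" using right_sq[OF c] ..
  obtain d' where d': "sq b (opp b v) d' c" using right_sq[OF sq_flip[OF c]] ..
  have "right (up f) = (c, opp c b, d')"
    using c sq_flip[OF d'] by (simp add: up_eq right_eq)
  moreover have "up (right f) = (c, d, opp c a)"
    using c d by (simp add: up_eq right_eq)
  ultimately show ?thesis
    using fourth_right[OF c d] fourth_right[OF sq_flip[OF c] d'] by simp
qed (simp add: non_frame)

section \<open>The action of the lattice on frames\<close>

definition walk :: "'a \<times> 'a \<times> 'a \<Rightarrow> int \<times> int \<Rightarrow> 'a \<times> 'a \<times> 'a" where
  "walk f z = zpow right (fst z) (zpow up (snd z) f)"

lemma zpow_right_up: "zpow right m (zpow up n f) = zpow up n (zpow right m f)"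
proof -
  have "up (zpow right m f) = zpow right m (up f)" for f
    by (rule zpow_intertwine[where h = up, OF bij_right bij_right right_up[symmetric]])
  then show ?thesis
    by (intro zpow_intertwine[where h = "zpow right m", OF bij_up bij_up]) simp
qed

lemma walk_0 [simp]: "walk f 0 = f"
  by (simp add: walk_def)

text \<open>Commutation of \<open>right\<close> and \<open>up\<close> makes \<open>walk\<close> an
  action of the additive group of the lattice.\<close>

lemma walk_add: "walk f (z + w) = walk (walk f w) z"
  by (simp add: walk_def zpow_add[OF bij_right] zpow_add[OF bij_up] zpow_right_up)

lemma walk_steps:
  "walk f (1, 0) = right f" "walk f (0, 1) = up f"
  "walk f (-1, 0) = inv right f" "walk f (0, -1) = inv up f"
  using zpow_add_1[OF bij_right, of 0 f] zpow_add_1[OF bij_up, of 0 f]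
    zpow_diff_1[OF bij_right, of 0 f] zpow_diff_1[OF bij_up, of 0 f]
  by (simp_all add: walk_def)

lemma walk_swap: "walk (swap f) (x, y) = swap (walk f (y, x))"
proof -
  have "swap (zpow right n g) = zpow up n (swap g)" for n g
    by (rule zpow_intertwine[where h = swap, OF bij_right bij_up]) (simp add: up_def)
  moreover have "swap (zpow up n g) = zpow right n (swap g)" for n g
    by (rule zpow_intertwine[where h = swap, OF bij_up bij_right]) (simp add: up_def)
  ultimately show ?thesis by (simp add: walk_def zpow_right_up)
qed

text \<open>\<open>mirror\<close> conjugates \<open>right\<close> to its inverse and commutes with
  \<open>up\<close>, so on coordinates it becomes the reflection of the first axis.\<close>

lemma walk_mirror: "walk (mirror f) (x, y) = mirror (walk f (- x, y))"
proof -
  have "mirror (zpow right n g) = zpow (inv right) n (mirror g)" for n g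
    by (rule zpow_intertwine[where h = mirror, OF bij_right bij_imp_bij_inv[OF bij_right]]) (simp add: inv_right)
  moreover have "mirror (zpow up n g) = zpow up n (mirror g)" for n g
    by (rule zpow_intertwine[where h = mirror, OF bij_up bij_up mirror_up])
  ultimately show ?thesis by (simp add: walk_def zpow_inv[OF bij_right])
qed

lemma walk_frame:
  assumes "f \<in> frames"
  shows "walk f z \<in> frames"
proof -
  have inv: "inv right g \<in> frames" if "g \<in> frames" for g
    using that by (simp add: inv_right mirror_frame right_frame)
  have R: "zpow right n g \<in> frames" if g: "g \<in> frames" for n g
    by (induction n rule: int_induct[where k = 0])
      (use g inv in \<open>simp_all add: zpow_add_1 zpow_diff_1 bij_right right_frame\<close>)
  have U: "zpow up n g \<in> frames" if g: "g \<in> frames" for n g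
    by (induction n rule: int_induct[where k = 0])
      (use g inv in \<open>simp_all add: zpow_add_1 zpow_diff_1 bij_up up_frame inv_up\<close>)
  show ?thesis by (simp add: walk_def R U assms)
qed

lemma fst_swap [simp]: "fst (swap f) = fst f"
  by (cases f) simp

lemma fst_mirror [simp]: "fst (mirror f) = fst f"
  by (cases f) (simp add: mirror.simps)

lemma fst_frame: "f \<in> frames \<Longrightarrow> fst f \<in> V"
  by (cases f) (auto dest: sq_vertex)

text \<open>Local bijectivity of the future covering map: the four steps from
  \<open>(v, a, b)\<close> end at \<open>a\<close>, \<open>opp v a\<close>, \<open>b\<close>,
  \<open>opp v b\<close>, which are all the neighbours of \<open>v\<close>.\<close>

lemma walk_nb:
  assumes "f \<in> frames"
  shows "bij_betw (\<lambda>e. fst (walk f e)) unit_steps (nb (fst f))"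
proof -
  obtain v a b c where f: "f = (v, a, b)" and c: "sq v a c b" using assms by (cases f) auto
  \<comment> \<open>Stated for any frame, so that the vertical steps follow by applying it to
    \<open>swap f\<close>.\<close>
  have R: "fst (right f) = a" "fst (inv right f) = opp v a"
    if "f = (v, a, b)" "sq v a c b" for f v a b c
    using that sq_opp[OF that(2)] by (auto simp: right_eq inv_right mirror_eq)
  have "fst (walk f (1, 0)) = a" "fst (walk f (-1, 0)) = opp v a"
    "fst (walk f (0, 1)) = b" "fst (walk f (0, -1)) = opp v b"
    unfolding walk_steps up_def inv_up fst_swap
    using R[OF f c] R[OF _ sq_flip[OF c], of "swap f"] f by auto
  with nb_sq[OF c] f show ?thesis
    by (auto simp: bij_betw_def unit_steps_def)
qed

text \<open>These maps form the dihedral group of the eight lattice symmetries fixing the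
  origin.\<close>

definition lattice_symmetry :: "(int \<times> int \<Rightarrow> int \<times> int) \<Rightarrow> bool" where
  "lattice_symmetry A \<longleftrightarrow> bij A \<and> A ` unit_steps = unit_steps \<and> (\<forall>z w. A (z + w) = A z + A w)"

lemma frames_at_vertex:
  assumes "f \<in> frames" "g \<in> frames" "fst f = fst g"
  obtains A where "lattice_symmetry A" "\<And>z. fst (walk f z) = fst (walk g (A z))"
proof -
  \<comment> \<open>The frames whose walks trace the same vertices as those of \<open>g\<close> up
    to a lattice symmetry. This set contains \<open>g\<close> and is closed under
    \<open>swap\<close> and \<open>mirror\<close>, which together reach every frame at the
    vertex.\<close>
  define rel where "rel = (\<lambda>f. \<exists>A. lattice_symmetry A \<and> (\<forall>z. fst (walk f z) = fst (walk g (A z))))"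
  have "lattice_symmetry id" by (simp add: lattice_symmetry_def)
  then have rel0: "rel g" unfolding rel_def by (metis id_apply)
  have comp: "lattice_symmetry (A \<circ> B)" if "lattice_symmetry A" "lattice_symmetry B" for A B
  proof -
    have "(A \<circ> B) ` unit_steps = unit_steps"
      using that by (simp only: lattice_symmetry_def image_comp[symmetric])
    then show ?thesis
      using that by (simp add: lattice_symmetry_def bij_comp del: split_paired_All)
  qed
  have step: "rel h'" if "rel h" "lattice_symmetry B" "\<And>z. fst (walk h' z) = fst (walk h (B z))" for h h' B
  proof -
    from that(1) obtain A where "lattice_symmetry A \<and> (\<forall>z. fst (walk h z) = fst (walk g (A z)))"
      unfolding rel_def ..
    then show ?thesis
      unfolding rel_def
      by (intro exI[of _ "A \<circ> B"]) (simp add: comp that(2,3) del: split_paired_All)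
  qed
  have "lattice_symmetry (\<lambda>(x, y). (y, x))"
    unfolding lattice_symmetry_def
    by (auto simp: unit_steps_def intro!: o_bij[of "\<lambda>(x, y). (y, x)"])
  then have relS: "rel (swap h)" if "rel h" for h
    by (rule step[OF that]) (auto simp: walk_swap)
  have "lattice_symmetry (\<lambda>(x, y). (- x, y))"
    unfolding lattice_symmetry_def
    by (auto simp: unit_steps_def intro!: o_bij[of "\<lambda>(x, y). (- x, y)"])
  then have relN: "rel (mirror h)" if "rel h" for h
    by (rule step[OF that]) (auto simp: walk_mirror)
  obtain v a b c where g: "g = (v, a, b)" and c: "sq v a c b" using assms(2) by (cases g) auto
  obtain a' b' c' where f: "f = (v, a', b')" and c': "sq v a' c' b'"
    using assms(1,3) g by (cases f) auto
  have r1: "rel (v, opp v x, y) \<and> (\<exists>c. sq v (opp v x) c y)" if "rel (v, x, y)" "sq v x c y" for x y c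
    using relN[OF that(1)] mirror_eq[OF that(2)] sq_opp[OF that(2)] by simp
  have r2: "rel (v, y, x)" if "rel (v, x, y)" for x y
    using relS[OF that] by simp
  \<comment> \<open>Reversing the second axis is \<open>mirror\<close> conjugated by
    \<open>swap\<close>.\<close>
  have r3: "rel (v, x, opp v y)" if "rel (v, x, y)" "sq v x c y" for x y c
    using r1[OF r2[OF that(1)] sq_flip[OF that(2)]] r2 by blast
  have rab: "rel (v, a, b)" using rel0 g by simp
  obtain d where d: "rel (v, opp v a, b)" "sq v (opp v a) d b" using r1[OF rab c] by blast
  have "rel (v, x, y)" if "x \<in> {a, opp v a}" "y \<in> {b, opp v b}" for x y
    using that rab d r3[OF rab c] r3[OF d] by auto
  \<comment> \<open>The axes of \<open>f\<close> are a perpendicular pair among the same four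
    neighbours: one from each opposite pair, in either order, the order being settled by
    \<open>r2\<close>.\<close>
  moreover have "a' \<in> {a, opp v a, b, opp v b}" "b' \<in> {a, opp v a, b, opp v b}" "b' \<noteq> a'" "b' \<noteq> opp v a'"
    using nb_sq[OF c'] nb_sq(1)[OF c] by auto
  moreover have "opp v (opp v a) = a" "opp v (opp v b) = b"
    using opp_opp c sq_flip by blast+
  ultimately have "rel f" unfolding f using r2 by auto
  then show ?thesis using that unfolding rel_def by blast
qed

end

section \<open>The covering map and its covering transformations\<close>

lemma neighbours_square_lattice: "neighbours \<L>\<^sup>2 u = (\<lambda>e. u + e) ` unit_steps"
  by (cases u) (auto simp: neighbours_def parcs_square_lattice_iff unit_steps_def image_iff)

lemma parcs_square_lattice: "(u, w) \<in> parcs \<L>\<^sup>2 \<longleftrightarrow> w - u \<in> unit_steps"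
  by (cases u; cases w) (auto simp: parcs_square_lattice_iff unit_steps_def)

lemma (in square_complex) normal_covering:
  assumes G: "pverts G = V" "\<And>v. v \<in> V \<Longrightarrow> neighbours G v = nb v" and "V \<noteq> {}"
  shows "\<exists>p. normal_covering_map p \<L>\<^sup>2 G"
proof -
  obtain f0 where f0: "f0 \<in> frames"
    using ex_sq \<open>V \<noteq> {}\<close> by (metis ex_in_conv frame_iff)
  define p where "p = (\<lambda>z. fst (walk f0 z))"
  have pV: "p z \<in> V" for z
    unfolding p_def by (intro fst_frame walk_frame f0)
  have p_add: "p (u + e) = fst (walk (walk f0 u) e)" for u e
    unfolding p_def by (metis walk_add add.commute)
  have bij: "bij_betw p (neighbours \<L>\<^sup>2 u) (neighbours G (p u))" for u
  proof -
    \<comment> \<open>By \<open>walk_add\<close>, stepping from \<open>u\<close> in the lattice is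
      stepping from the frame \<open>walk f0 u\<close>.\<close>
    have "bij_betw (p \<circ> (\<lambda>e. u + e)) unit_steps (nb (p u))"
      using walk_nb[OF walk_frame[OF f0], of u] by (simp add: o_def p_add) (simp add: p_def)
    then show ?thesis
      unfolding neighbours_square_lattice G(2)[OF pV]
      by (subst (asm) bij_betw_comp_iff[symmetric, where A' = "(\<lambda>e. u + e) ` unit_steps"])
        (auto simp: bij_betw_def)
  qed
  have "graph_hom p \<L>\<^sup>2 G"
    unfolding graph_hom_def
  proof (intro conjI ballI funcsetI)
    show "p z \<in> pverts G" for z using pV G by simp
    fix a assume "a \<in> parcs \<L>\<^sup>2"
    then show "case a of (u, v) \<Rightarrow> (p u, p v) \<in> parcs G"
      using bij[of "fst a"] by (auto simp: bij_betw_def neighbours_def)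
  qed
  moreover have "\<exists>\<phi> \<in> covering_transformations p \<L>\<^sup>2. \<phi> u = v" if uv: "p u = p v" for u v
  proof -
    \<comment> \<open>The frames reached at \<open>u\<close> and \<open>v\<close> share their base
      vertex, so their walks differ by a lattice symmetry.\<close>
    obtain A where A: "lattice_symmetry A"
      "\<And>z. fst (walk (walk f0 u) z) = fst (walk (walk f0 v) (A z))"
      using frames_at_vertex[OF walk_frame[OF f0] walk_frame[OF f0]] uv unfolding p_def by metis
    then have "bij A" and add: "\<And>z w. A (z + w) = A z + A w" and im: "A ` unit_steps = unit_steps"
      by (auto simp: lattice_symmetry_def)
    \<comment> \<open>The affine map with linear part \<open>A\<close> taking \<open>u\<close> to
      \<open>v\<close>. It preserves \<open>p\<close> by the choice of \<open>A\<close>, and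
      adjacency because differences transform by \<open>A\<close>.\<close>
    define \<phi> where "\<phi> z = v + A (z - u)" for z
    have "bij \<phi>"
    proof -
      have "\<phi> = (\<lambda>z. v + z) \<circ> A \<circ> (\<lambda>z. z - u)" by (simp add: fun_eq_iff \<phi>_def)
      moreover have "bij (\<lambda>z. v + z)" "bij (\<lambda>z. z - u)"
        by (rule o_bij[of "\<lambda>z. z - v"], auto) (rule o_bij[of "\<lambda>z. z + u"], auto)
      ultimately show ?thesis using \<open>bij A\<close> by (simp only: bij_comp)
    qed
    moreover have "\<phi> w - \<phi> z \<in> unit_steps \<longleftrightarrow> w - z \<in> unit_steps" for w z
    proof -
      have "\<phi> w = A (w - z) + \<phi> z"
        using add[of "w - z" "z - u"] by (simp add: \<phi>_def)
      then have "\<phi> w - \<phi> z = A (w - z)" by simp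
      then show ?thesis using im \<open>bij A\<close> by (metis bij_is_inj inj_image_mem_iff)
    qed
    ultimately have "graph_iso \<phi> (with_proj \<L>\<^sup>2) (with_proj \<L>\<^sup>2)"
      using pair_bidirected_digraph_square_lattice
      by (subst graph_iso_iff)
        (auto simp: parcs_square_lattice pair_bidirected_digraph_def pair_sym_digraph_def)
    moreover have "p (\<phi> z) = p z" for z
      using A(2)[of "z - u"] p_add[of u "z - u"] p_add[of v "A (z - u)"] by (simp add: \<phi>_def)
    ultimately have "\<phi> \<in> covering_transformations p \<L>\<^sup>2"
      by (simp add: covering_transformations_def)
    moreover have "\<phi> u = v"
      using add[of 0 0] by (simp add: \<phi>_def)
    ultimately show ?thesis by blast
  qed
  ultimately show ?thesis
    unfolding normal_covering_map_def covering_map_def using bij by (intro exI[of _ p]) auto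
qed

section \<open>Stars in a graph with the 4-cycle wheel property\<close>

definition cyc :: "'a \<Rightarrow> 'a \<Rightarrow> 'a \<Rightarrow> 'a \<Rightarrow> 'a pair_pre_digraph" where
  "cyc a b c d = mk_symmetric (with_proj
     \<lparr> pverts = {a, b, c, d}, parcs = {(a, b), (b, c), (c, d), (d, a)} \<rparr>)"

lemma pverts_cyc [simp]: "pverts (cyc a b c d) = {a, b, c, d}"
  by (simp add: cyc_def)

lemma parcs_cyc [simp]:
  "parcs (cyc a b c d) = {(a, b), (b, a), (b, c), (c, b), (c, d), (d, c), (d, a), (a, d)}"
  by (auto simp: cyc_def parcs_mk_symmetric)

lemma cyc_rot: "cyc a b c d = cyc b c d a"
  by (rule pair_pre_digraph.equality) auto

lemma cyc_flip: "cyc a b c d = cyc a d c b"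
  by (rule pair_pre_digraph.equality) auto

lemma four_cycle_iff: "four_cycle H \<longleftrightarrow> (\<exists>a b c d. distinct [a, b, c, d] \<and> H = cyc a b c d)"
  by (simp add: four_cycle_def cyc_def)

text \<open>Rotating the labels puts \<open>v\<close> first, so that \<open>c\<close> is the corner
  opposite to \<open>v\<close>.\<close>

lemma four_cycle_at:
  assumes "four_cycle H" "v \<in> pverts H"
  obtains a c b where "distinct [v, a, c, b]" "H = cyc v a c b"
proof -
  obtain x y z w where H: "distinct [x, y, z, w]" "H = cyc x y z w"
    using assms(1) by (auto simp only: four_cycle_iff)
  have "H = cyc y z w x" "H = cyc z w x y" "H = cyc w x y z"
    unfolding H(2) by (metis cyc_rot)+
  moreover have "distinct [y, z, w, x]" "distinct [z, w, x, y]" "distinct [w, x, y, z]"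
    using H(1) by auto
  moreover have "v = x \<or> v = y \<or> v = z \<or> v = w" using assms(2) H(2) by auto
  ultimately show thesis using H that by metis
qed

text \<open>A 4-cycle of the lattice through the origin is a unit square: opposite steps
  \<open>e\<close> and \<open>- e\<close> have only the origin as common neighbour.\<close>

lemma unit_square:
  assumes "e \<in> unit_steps" "f \<in> unit_steps" "c - e \<in> unit_steps" "c - f \<in> unit_steps"
    and "e \<noteq> f" "c \<noteq> 0"
  shows "f \<noteq> - e" "c = e + f"
proof -
  obtain x y where c: "c = (x, y)" by fastforce
  show "f \<noteq> - e" "c = e + f"
    using assms unfolding unit_steps_def c by (elim insertE emptyE; simp add: zero_prod_def)+
qed

lemma unit_steps_sum:
  assumes "e \<in> unit_steps" "f \<in> unit_steps" "f \<noteq> e" "f \<noteq> - e"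
  shows "e + f \<in> {-1..1} \<times> {-1..1}" "e + f \<noteq> 0" "e + f \<notin> unit_steps"
  using assms unfolding unit_steps_def by (elim insertE emptyE; simp add: zero_prod_def)+

text \<open>A diagonal corner of the grid determines the two steps spanning it, up to order.\<close>

lemma unit_steps_sum_inj:
  assumes "e \<in> unit_steps" "f \<in> unit_steps" "f \<noteq> e" "f \<noteq> - e"
    and "e' \<in> unit_steps" "f' \<in> unit_steps" "e + f = e' + f'"
  shows "e = e' \<and> f = f' \<or> e = f' \<and> f = e'"
  using assms unfolding unit_steps_def by (elim insertE emptyE; simp add: zero_prod_def)+

lemma grid3_eq:
  "grid3 = with_proj \<lparr> pverts = {-1..1} \<times> {-1..1},
     parcs = {(x, y). y - x \<in> unit_steps \<and> x \<in> {-1..1} \<times> {-1..1} \<and> y \<in> {-1..1} \<times> {-1..1}} \<rparr>"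
  by (auto simp: grid3_def induce_subgraph_def with_proj_def parcs_square_lattice)

text \<open>The chart is the inverse of the wheel isomorphism. Cycles of \<open>C\<close> through
  \<open>v\<close> become unit squares at the origin; conversely, each corner of the grid lies on
  the image of such a cycle and identifies it.\<close>

lemma wheel_star_chart:
  assumes G: "card (neighbours G v) = 4"
    and C: "\<And>H. H \<in> C \<Longrightarrow> four_cycle H \<and> subgraph (with_proj H) (with_proj G)"
    and iso: "graph_iso \<phi> (pre_digraph.Union (with_proj G) (with_proj ` {H \<in> C. v \<in> pverts H})) grid3"
    and \<phi>v: "\<phi> v = (0, 0)"
  shows "\<exists>\<psi>. star_chart (neighbours G v) (\<lambda>a c b. distinct [v, a, c, b] \<and> cyc v a c b \<in> C) \<psi>"
proof -
  \<comment> \<open>The union of the cycles through \<open>v\<close> as a pair digraph, so that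
    \<open>graph_iso_iff\<close> applies.\<close>
  define W where "W = \<lparr> pverts = \<Union>(pverts ` {H \<in> C. v \<in> pverts H}),
    parcs = \<Union>(parcs ` {H \<in> C. v \<in> pverts H}) \<rparr>"
  let ?grid = "{-1..1} \<times> {-1..1} :: (int \<times> int) set"
  have W: "pre_digraph.Union (with_proj G) (with_proj ` {H \<in> C. v \<in> pverts H}) = with_proj W"
    by (simp add: pre_digraph.Union_def with_proj_def W_def image_image)
  have "pair_wf_digraph H" if "H \<in> C" for H
    using C[OF that] by (simp add: subgraph_def wf_digraph_wp_iff)
  then have "pair_wf_digraph W"
    unfolding pair_wf_digraph_def W_def by fastforce
  moreover have "pair_wf_digraph \<lparr> pverts = ?grid,
     parcs = {(x, y). y - x \<in> unit_steps \<and> x \<in> ?grid \<and> y \<in> ?grid} \<rparr>"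
    by unfold_locales auto
  ultimately have bij: "bij_betw \<phi> (pverts W) ?grid"
    and arcs: "\<And>x y. x \<in> pverts W \<Longrightarrow> y \<in> pverts W \<Longrightarrow> (x, y) \<in> parcs W \<Longrightarrow> \<phi> y - \<phi> x \<in> unit_steps"
    using iso unfolding W grid3_eq by (auto simp: graph_iso_iff)
  define \<psi> where "\<psi> = inv_into (pverts W) \<phi>"
  have \<psi>\<phi>: "\<psi> (\<phi> x) = x" if "x \<in> pverts W" for x
    using bij_betw_inv_into_left[OF bij that] by (simp add: \<psi>_def)
  have \<phi>\<psi>: "\<phi> (\<psi> z) = z" "\<psi> z \<in> pverts W" if "z \<in> ?grid" for z
    using bij_betw_inv_into_right[OF bij that] that bij
    by (auto simp: \<psi>_def bij_betw_def intro!: inv_into_into)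
  have square: "\<phi> a \<in> unit_steps \<and> \<phi> b \<in> unit_steps \<and> \<phi> b \<noteq> \<phi> a \<and> \<phi> b \<noteq> - \<phi> a \<and>
      \<phi> c = \<phi> a + \<phi> b \<and> {v, a, b, c} \<subseteq> pverts W"
    if d: "distinct [v, a, c, b]" and H: "cyc v a c b \<in> C" for a b c
  proof -
    have sub: "pverts (cyc v a c b) \<subseteq> pverts W" "parcs (cyc v a c b) \<subseteq> parcs W"
      using H by (auto simp: W_def)
    have inj: "\<phi> x \<noteq> \<phi> y" if "x \<noteq> y" "x \<in> {v, a, c, b}" "y \<in> {v, a, c, b}" for x y
      using that sub(1) \<psi>\<phi> by (metis pverts_cyc subsetD)
    have "\<phi> a - \<phi> v \<in> unit_steps" "\<phi> b - \<phi> v \<in> unit_steps"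
      "\<phi> c - \<phi> a \<in> unit_steps" "\<phi> c - \<phi> b \<in> unit_steps"
      using sub by (auto intro!: arcs)
    then have u: "\<phi> a \<in> unit_steps" "\<phi> b \<in> unit_steps"
      "\<phi> c - \<phi> a \<in> unit_steps" "\<phi> c - \<phi> b \<in> unit_steps"
      by (simp_all add: \<phi>v flip: zero_prod_def)
    have "\<phi> a \<noteq> \<phi> b" "\<phi> c \<noteq> 0"
      using inj[of a b] inj[of c v] d by (auto simp: \<phi>v zero_prod_def)
    from unit_square[OF u this] u \<open>\<phi> a \<noteq> \<phi> b\<close> sub(1) show ?thesis by simp
  qed
  have ex: "distinct [v, \<psi> e, \<psi> (e + f), \<psi> f] \<and> cyc v (\<psi> e) (\<psi> (e + f)) (\<psi> f) \<in> C"
    if ef: "e \<in> unit_steps" "f \<in> unit_steps" "f \<noteq> e" "f \<noteq> - e" for e f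
  proof -
    note s = unit_steps_sum[OF ef]
    obtain H where H: "H \<in> C" "v \<in> pverts H" "\<psi> (e + f) \<in> pverts H"
      using \<phi>\<psi>(2)[OF s(1)] by (auto simp: W_def)
    obtain a c b where acb: "distinct [v, a, c, b]" "H = cyc v a c b"
      using four_cycle_at C H(1,2) by metis
    note sq = square[OF acb(1) H(1)[unfolded acb(2)]]
    \<comment> \<open>Being neither the centre nor a unit step, \<open>e + f\<close> must be the
      corner \<open>\<phi> c\<close> opposite to the centre.\<close>
    have "e + f \<in> {0, \<phi> a, \<phi> c, \<phi> b}"
      using H(3) \<phi>\<psi>(1)[OF s(1)] acb(2) \<phi>v by (auto simp: zero_prod_def)
    then have sum: "e + f = \<phi> a + \<phi> b" using s sq by auto
    then have c: "\<psi> (e + f) = c" using sq \<psi>\<phi> by (metis insert_subset)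
    have ab: "\<psi> (\<phi> a) = a" "\<psi> (\<phi> b) = b" using sq \<psi>\<phi> by auto
    from unit_steps_sum_inj[OF ef _ _ sum] sq
    have "e = \<phi> a \<and> f = \<phi> b \<or> e = \<phi> b \<and> f = \<phi> a" by blast
    then show ?thesis
      using acb H(1) c ab cyc_flip[of v a c b] by auto
  qed
  have "unit_steps \<subseteq> ?grid" by (auto simp: unit_steps_def)
  then have inj: "inj_on \<psi> unit_steps"
    using \<phi>\<psi>(1) by (intro inj_on_inverseI[of _ \<phi>]) blast
  have "\<psi> e \<in> neighbours G v" if e: "e \<in> unit_steps" for e
  proof -
    \<comment> \<open>Exchanging coordinates gives a step perpendicular to \<open>e\<close>, hence a
      cycle containing the edge from \<open>v\<close> to \<open>\<psi> e\<close>.\<close>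
    have "(snd e, fst e) \<in> unit_steps" "(snd e, fst e) \<noteq> e" "(snd e, fst e) \<noteq> - e"
      using e unfolding unit_steps_def by auto
    from ex[OF e this] obtain c b where "cyc v (\<psi> e) c b \<in> C" by blast
    then have "parcs (cyc v (\<psi> e) c b) \<subseteq> parcs G"
      using C by (auto simp: subgraph_def simp del: parcs_cyc)
    then show ?thesis by (simp add: neighbours_def)
  qed
  moreover have "card (\<psi> ` unit_steps) = 4"
    using card_image[OF inj] by (simp add: unit_steps_def)
  moreover have "finite (neighbours G v)" using G by (metis card.infinite zero_neq_numeral)
  \<comment> \<open>Four distinct neighbours have been found, and the degree is four.\<close>
  ultimately have nb: "neighbours G v = \<psi> ` unit_steps"
    using G by (intro card_subset_eq[symmetric]) auto
  have only: "\<exists>e\<in>unit_steps. \<exists>f\<in>unit_steps.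
      f \<noteq> e \<and> f \<noteq> - e \<and> a = \<psi> e \<and> b = \<psi> f \<and> c = \<psi> (e + f)"
    if "distinct [v, a, c, b] \<and> cyc v a c b \<in> C" for a b c
  proof -
    have sq: "\<phi> a \<in> unit_steps" "\<phi> b \<in> unit_steps" "\<phi> b \<noteq> \<phi> a" "\<phi> b \<noteq> - \<phi> a"
      "\<phi> c = \<phi> a + \<phi> b" "a \<in> pverts W" "b \<in> pverts W" "c \<in> pverts W"
      using square[of a c b] that by simp_all
    then have "a = \<psi> (\<phi> a)" "b = \<psi> (\<phi> b)" "c = \<psi> (\<phi> a + \<phi> b)"
      using \<psi>\<phi> by (simp_all flip: sq(5))
    with sq show ?thesis by blast
  qed
  have "star_chart (neighbours G v) (\<lambda>a c b. distinct [v, a, c, b] \<and> cyc v a c b \<in> C) \<psi>"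
    unfolding star_chart_def
  proof (intro conjI[OF inj] conjI[OF nb] allI iffI)
    fix a c b
    assume "\<exists>e\<in>unit_steps. \<exists>f\<in>unit_steps. f \<noteq> e \<and> f \<noteq> - e \<and> a = \<psi> e \<and> b = \<psi> f \<and> c = \<psi> (e + f)"
    then show "distinct [v, a, c, b] \<and> cyc v a c b \<in> C"
      by (elim bexE conjE, hypsubst) (rule ex)
  qed (rule only)
  then show ?thesis by (rule exI[of _ \<psi>])
qed

theorem theorem2:
  fixes G :: "'a pair_pre_digraph"
  assumes "pair_graph G"
    and "connected (with_proj G)"
    and "four_cycle_wheel_property G"
  shows "\<exists>p :: int \<times> int \<Rightarrow> 'a. normal_covering_map p \<L>\<^sup>2 G"
proof -
  obtain C where C: "\<And>H. H \<in> C \<Longrightarrow> four_cycle H \<and> subgraph (with_proj H) (with_proj G)"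
    and wheel: "\<And>v. v \<in> pverts G \<Longrightarrow> \<exists>\<phi>. graph_iso \<phi>
      (pre_digraph.Union (with_proj G) (with_proj ` {H \<in> C. v \<in> pverts H})) grid3 \<and> \<phi> v = (0, 0)"
    using assms(3) unfolding four_cycle_wheel_property_def by blast
  have card: "card (neighbours G v) = 4" if "v \<in> pverts G" for v
    using assms(3) that by (simp add: four_cycle_wheel_property_def regular_def)
  \<comment> \<open>The squares are the labelled cycles of \<open>C\<close>; rotating or flipping
    the labels leaves the cycle unchanged.\<close>
  interpret square_complex "pverts G" "neighbours G"
    "\<lambda>a b c d. distinct [a, b, c, d] \<and> cyc a b c d \<in> C"
  proof
    fix a b c d
    assume *: "distinct [a, b, c, d] \<and> cyc a b c d \<in> C"
    show "distinct [b, c, d, a] \<and> cyc b c d a \<in> C"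
      using * cyc_rot[of a b c d] by auto
    show "distinct [a, d, c, b] \<and> cyc a d c b \<in> C"
      using * cyc_flip[of a b c d] by auto
    show "a \<in> pverts G"
      using * C[of "cyc a b c d"] by (auto simp: subgraph_def)
  next
    fix v assume "v \<in> pverts G"
    then show "\<exists>\<psi>. star_chart (neighbours G v) (\<lambda>a c b. distinct [v, a, c, b] \<and> cyc v a c b \<in> C) \<psi>"
      using wheel wheel_star_chart[OF card C] by blast
  qed
  \<comment> \<open>Connectedness includes having a vertex, which provides the initial
    frame.\<close>
  have "pverts G \<noteq> {}"
    using assms(2) by (simp add: connected_def strongly_connected_def)
  then show ?thesis by (intro normal_covering) simp_all
qed

end
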